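(* Let $t\ge3$ and $n\ge2$ be integers, $g=(n^2+n)t-1$, $k=n^2t-1$. Then $Y(g,k)\in Z_3$. Precisely, writing $N_A=[nt-(n+1),\,n^2t-(n+1)]$, $N_B=[(n^2-n)t+2n-2,\,(n^2-n)t+2n-2]$, $N_C=[n^2t-(n+1),\,nt-(n+1)]$, the graph $Y(g,k)$ consists of the nodes $[[0,0]],N_A,N_B,N_C,[0,0]$ and exactly the edges: $[[0,0]]\to N_A$ labeled $(1,(n^2+n)t-(n+2))$; $N_A\to N_B$ labeled $((n+1)t-(n+2),(n^2-1)t+2n-1)$; $N_B\to N_C$ labeled $((n^2-1)t+2n-1,(n+1)t-(n+2))$; $N_C\to N_A$ labeled $((n^2+n)t-(n+1),(n^2+n)t-(n+1))$; $N_C\to[0,0]$ labeled $((n^2+n)t-(n+2),1)$; $[0,0]\to N_A$ labeled $(1,(n^2+n)t-(n+2))$; and a self-loop at $[0,0]$ labeled $(0,0)$.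
   Context: For integers $2\le k<g$, the labeled directed graph $H(g,k)$ has a distinguished starting node $[[0,0]]$ and other nodes labeled by pairs $[R,r]$ of integers with $0\le R,r\le k-1$ (the node $[0,0]$ is distinct from the starting node). For a node $[P,p]$ (the starting node treated as $[0,0]$ here) there is an edge labeled $(A,a)$ from $[P,p]$ to $[R,r]$ whenever $0\le A,a\le g-1$ are integers, $0\le R,r\le k-1$, $ka+p=A+rg$ and $kA+R=a+Pg$; edges leaving the starting node additionally require $A\ne0\ne a$; no edge enters the starting node. $H(g,k)$ consists of the starting node and all nodes reachable from it. An even pivot node is a node $[a,a]$; an odd pivot node is a node $[r,s]$ with an edge to $[s,r]$; the starting node is not a pivot node. $Y(g,k)$ is obtained from $H(g,k)$ by deleting every node that is not a pivot node and from which no pivot node is reachable, with incident edges. A Young graph is a cyclic Young graph on $n$ nodes if its nodes other than the starting node and $[0,0]$ form the cyclic directed graph on $n$ nodes, and there are nodes $N_1$ and $N_2\ne[0,0]$ with $N_1$ directly preceding $N_2$, such that the only direct predecessor of $[0,0]$ other than itself is $N_1$ and the only direct successor of $[0,0]$ (other than itself) and of the starting node is $N_2$. $Z_n$ is the class of cyclic Young graphs on $n$ nodes. *)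

theory Defs
  imports "Graph_Theory.Graph_Theory"
begin

(* Start is the distinguished starting node [[0,0]]; Node 0 0 is the different node [0,0]. *)
datatype node = Start | Node int int

fun node_label :: "node \<Rightarrow> int \<times> int" where
  "node_label Start = (0, 0)"
| "node_label (Node P p) = (P, p)"

(* An arc (u, (A, a), v) goes from u to v and carries the edge label (A, a). *)
type_synonym labeled_arc = "node \<times> (int \<times> int) \<times> node"

definition all_nodes :: "int \<Rightarrow> node set" where
  "all_nodes k = insert Start {Node R r | R r. 0 \<le> R \<and> R \<le> k - 1 \<and> 0 \<le> r \<and> r \<le> k - 1}"

definition labeled_arcs :: "int \<Rightarrow> int \<Rightarrow> labeled_arc set" where
  "labeled_arcs g k = {(u, (A, a), Node R r) | u A a R r P p.
     u \<in> all_nodes k \<and> Node R r \<in> all_nodes k \<and> node_label u = (P, p) \<and>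
     0 \<le> A \<and> A \<le> g - 1 \<and> 0 \<le> a \<and> a \<le> g - 1 \<and>
     k * a + p = A + r * g \<and> k * A + R = a + P * g \<and>
     (u = Start \<longrightarrow> A \<noteq> 0 \<and> a \<noteq> 0)}"

definition full_graph :: "int \<Rightarrow> int \<Rightarrow> (node, labeled_arc) pre_digraph" where
  "full_graph g k = \<lparr> verts = all_nodes k, arcs = labeled_arcs g k,
     tail = (\<lambda>(u, l, v). u), head = (\<lambda>(u, l, v). v) \<rparr>"

definition H_graph :: "int \<Rightarrow> int \<Rightarrow> (node, labeled_arc) pre_digraph" where
  "H_graph g k = full_graph g k \<restriction> {v. Start \<rightarrow>\<^sup>*\<^bsub>full_graph g k\<^esub> v}"

definition even_pivot :: "(node, labeled_arc) pre_digraph \<Rightarrow> node \<Rightarrow> bool" where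
  "even_pivot G v \<longleftrightarrow> v \<in> verts G \<and> (\<exists>a. v = Node a a)"

definition odd_pivot :: "(node, labeled_arc) pre_digraph \<Rightarrow> node \<Rightarrow> bool" where
  "odd_pivot G v \<longleftrightarrow> v \<in> verts G \<and> (\<exists>r s. v = Node r s \<and> Node r s \<rightarrow>\<^bsub>G\<^esub> Node s r)"

definition pivot :: "(node, labeled_arc) pre_digraph \<Rightarrow> node \<Rightarrow> bool" where
  "pivot G v \<longleftrightarrow> even_pivot G v \<or> odd_pivot G v"

(* Library reachability is reflexive on vertices, so the pivot nodes themselves are kept. *)
definition Y_graph :: "int \<Rightarrow> int \<Rightarrow> (node, labeled_arc) pre_digraph" where
  "Y_graph g k = H_graph g k \<restriction>
     {u \<in> verts (H_graph g k). \<exists>v. pivot (H_graph g k) v \<and> u \<rightarrow>\<^sup>*\<^bsub>H_graph g k\<^esub> v}"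

(* For n = 1 this is a single vertex with a loop. *)
definition cyclic_digraph :: "nat \<Rightarrow> (nat, nat \<times> nat) pre_digraph" where
  "cyclic_digraph n = \<lparr> verts = {..<n}, arcs = {(i, Suc i mod n) | i. i < n},
     tail = fst, head = snd \<rparr>"

definition is_cyclic_young :: "nat \<Rightarrow> (node, labeled_arc) pre_digraph \<Rightarrow> bool" where
  "is_cyclic_young n G \<longleftrightarrow>
     digraph_iso (G \<restriction> (verts G - {Start, Node 0 0})) (cyclic_digraph n) \<and>
     (\<exists>N1 N2. N2 \<noteq> Node 0 0 \<and> N1 \<rightarrow>\<^bsub>G\<^esub> N2 \<and>
        {u. u \<rightarrow>\<^bsub>G\<^esub> Node 0 0} - {Node 0 0} = {N1} \<and>
        {v. Node 0 0 \<rightarrow>\<^bsub>G\<^esub> v} - {Node 0 0} = {N2} \<and>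
        {v. Start \<rightarrow>\<^bsub>G\<^esub> v} = {N2})"

definition Z_class :: "nat \<Rightarrow> (node, labeled_arc) pre_digraph set" where
  "Z_class n = {Y_graph g k | g k. 2 \<le> k \<and> k < g \<and> is_cyclic_young n (Y_graph g k)}"

end

(*
  Put d = n t, so that k = n d - 1 and g = (n + 1) d - 1. For an edge labeled (A, a) from
  [P, p] to [R, r] let u = n a - (n + 1) r. The two edge equations turn into
    R = g (u + P) + (n + 1) p - (d + 1) n A,
    (d + 1) r - R = d (n d - 2) u + k p - g P.
  The left side of the second equation lies in [-(n d - 2), (d + 1) (n d - 2)], which leaves at
  most two values of u for each source. Since (d + 1) n > k, the first equation and 0 <= R < k
  then leave at most one A for each u. Hence the out-edges of the origin, N_A, N_B and N_C can be
  listed: u is 0 or 1, then 2 - n, then 1, then n or n + 1. So H(g, k) already has only these nodes,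
  and all of them reach the even pivot node [0, 0].
*)

theory Submission
  imports Defs
begin

section \<open>The edge relation on pairs of integers\<close>

definition young_edge :: "int \<Rightarrow> int \<Rightarrow> int \<times> int \<Rightarrow> int \<times> int \<Rightarrow> int \<times> int \<Rightarrow> bool" where
  "young_edge g k = (\<lambda>(P, p) (A, a) (R, r).
     0 \<le> A \<and> A \<le> g - 1 \<and> 0 \<le> a \<and> a \<le> g - 1 \<and>
     0 \<le> R \<and> R \<le> k - 1 \<and> 0 \<le> r \<and> r \<le> k - 1 \<and>
     k * a + p = A + r * g \<and> k * A + R = a + P * g)"

text \<open>Reduces arcs to arithmetic on labels, so that \<open>Start\<close> and
  \<open>Node 0 0\<close>, both labeled \<open>(0, 0)\<close>, share one analysis. Since
  \<open>young_edge\<close> bounds only the label and the target, membership of the source in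
  \<open>all_nodes k\<close> stays a separate conjunct; \<open>w \<noteq> Start\<close> is needed
  because labels cannot tell \<open>Start\<close> from \<open>Node 0 0\<close>.\<close>

lemma labeled_arcs_iff:
  "(v, (A, a), w) \<in> labeled_arcs g k \<longleftrightarrow>
     v \<in> all_nodes k \<and> w \<noteq> Start \<and> young_edge g k (node_label v) (A, a) (node_label w) \<and>
     (v = Start \<longrightarrow> A \<noteq> 0 \<and> a \<noteq> 0)"
  by (cases v; cases w) (auto simp: labeled_arcs_def young_edge_def all_nodes_def)

lemma young_edge_target: "young_edge g k x l y \<Longrightarrow> case_prod Node y \<in> all_nodes k"
  by (cases x; cases l; cases y) (auto simp: young_edge_def all_nodes_def)

section \<open>Parameters, estimates and the edge equations in terms of \<open>u\<close>\<close>

locale young_params =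
  fixes n t d g k :: int
  assumes n: "n \<ge> 2" and t: "t \<ge> 3"
    and d: "d = n * t" and k: "k = n * d - 1" and g: "g = (n + 1) * d - 1"
begin

lemma d_ge: "d \<ge> 3 * n"
  using mult_left_mono[of 3 t n] n t by (simp add: d)

text \<open>Together with \<open>nd_bounds\<close>, supplies the comparisons between the monomials
  \<open>d\<close>, \<open>n * d\<close>, \<open>d * d\<close> and \<open>n * (d * d)\<close> that
  purely linear reasoning cannot find. The condition \<open>t \<ge> 3\<close> enters through
  \<open>d * d \<ge> 3 * (n * d)\<close>.\<close>

lemma d_bounds: "d \<ge> 6" "n * d \<ge> 12" "d * d \<ge> 3 * (n * d)"
proof -
  show d6: "d \<ge> 6" using d_ge n by linarith
  show "n * d \<ge> 12" using mult_mono[of 2 n 6 d] d6 n by simp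
  show "d * d \<ge> 3 * (n * d)" using mult_right_mono[OF d_ge, of d] d6 by simp
qed

lemma nd_bounds: "n * (d * d) \<ge> 2 * (d * d)" "n * (d * d) \<ge> 6 * (n * d)" "n * d \<ge> 2 * d"
  using n d_bounds mult_right_mono[of 6 d "n * d"] by (auto intro: mult_right_mono simp: mult_ac)

text \<open>Collecting the multiples of \<open>d\<close> in the first edge equation gives
  \<open>a = d * u + p + r - A\<close>; putting this into the definition of \<open>u\<close> yields
  \<open>r\<close>, and the second edge equation then yields \<open>R\<close>. Both
  \<open>(d + 1) * r\<close> and \<open>R\<close> contain \<open>A\<close> with coefficient
  \<open>- (d + 1) * n\<close>, so their difference is free of \<open>A\<close>.\<close>

lemma edge_formulas:
  assumes "young_edge g k (P, p) (A, a) (R, r)" and u: "u = n * a - (n + 1) * r"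
  shows edge_r: "r = k * u + n * (p - A)"
    and edge_R: "R = g * (u + P) + (n + 1) * p - (d + 1) * n * A"
    and edge_u: "(d + 1) * r - R = d * (n * d - 2) * u + k * p - g * P"
proof -
  have 1: "k * a + p = A + r * g" and 2: "k * A + R = a + P * g"
    using assms by (auto simp: young_edge_def)
  have a1: "a = d * u + p + r - A"
    using 1 by (simp add: u k g algebra_simps)
  have "n * a = n * d * u + n * p + n * r - n * A"
    by (subst a1) (simp add: algebra_simps)
  moreover have "k * u = n * d * u - u" "n * (p - A) = n * p - n * A" "(n + 1) * r = n * r + r"
    by (simp_all add: k algebra_simps)
  ultimately show r: "r = k * u + n * (p - A)"
    using u by linarith
  show R: "R = g * (u + P) + (n + 1) * p - (d + 1) * n * A"
    using 2 unfolding a1 r by (simp add: k g algebra_simps)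
  show "(d + 1) * r - R = d * (n * d - 2) * u + k * p - g * P"
    unfolding r R by (simp add: k g algebra_simps)
qed

text \<open>Both \<open>r\<close> and \<open>R\<close> lie between 0 and
  \<open>k - 1 = n * d - 2\<close>. The resulting interval has length
  \<open>(d + 2) * (n * d - 2)\<close>, less than two steps of size
  \<open>d * (n * d - 2)\<close>.\<close>

lemma edge_u_bounds:
  assumes e: "young_edge g k (P, p) (A, a) (R, r)" and u: "u = n * a - (n + 1) * r"
  shows "- (n * d - 2) \<le> d * (n * d - 2) * u + k * p - g * P"
    and "d * (n * d - 2) * u + k * p - g * P \<le> (d + 1) * (n * d - 2)"
proof -
  have r: "0 \<le> r" "r \<le> n * d - 2" and R: "0 \<le> R" "R \<le> n * d - 2"
    using e by (auto simp: young_edge_def k)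
  have "0 \<le> (d + 1) * r" "(d + 1) * r \<le> (d + 1) * (n * d - 2)"
    using r d_bounds by (auto intro: mult_left_mono)
  then show "- (n * d - 2) \<le> d * (n * d - 2) * u + k * p - g * P"
    and "d * (n * d - 2) * u + k * p - g * P \<le> (d + 1) * (n * d - 2)"
    using R edge_u[OF e u] by auto
qed

lemma edge_unique:
  assumes e: "young_edge g k (P, p) (A, a) (R, r)"
    and e': "young_edge g k (P, p) (A', a') (R', r')"
    and eq: "n * a - (n + 1) * r = n * a' - (n + 1) * r'"
  shows "A = A' \<and> a = a' \<and> R = R' \<and> r = r'"
proof -
  define u where "u = n * a - (n + 1) * r"
  note u' = u_def[unfolded eq]
  have R: "0 \<le> R" "R \<le> n * d - 2" "0 \<le> R'" "R' \<le> n * d - 2"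
    using e e' by (auto simp: young_edge_def k)
  \<comment> \<open>\<open>R - R'\<close> is a multiple of \<open>(d + 1) * n = k + n + 1\<close>
    but smaller than \<open>k\<close> in absolute value, so it vanishes.\<close>
  have diff: "(d + 1) * n * (A' - A) = R - R'"
    using edge_R[OF e u_def] edge_R[OF e' u'] by (simp add: algebra_simps)
  have "A' = A"
  proof (rule ccontr)
    assume "A' \<noteq> A"
    then consider "A' - A \<ge> 1" | "A' - A \<le> - 1" by linarith
    then show False
    proof cases
      case 1
      have "(d + 1) * n * 1 \<le> (d + 1) * n * (A' - A)"
        using 1 n d_bounds by (intro mult_left_mono) auto
      then show False using diff R n by (simp add: algebra_simps)
    next
      case 2
      have "(d + 1) * n * (A' - A) \<le> (d + 1) * n * (- 1)"
        using 2 n d_bounds by (intro mult_left_mono) auto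
      then show False using diff R n by (simp add: algebra_simps)
    qed
  qed
  moreover have "R = R'" using diff calculation by simp
  moreover have "r = r'"
    using edge_r[OF e u_def] edge_r[OF e' u'] calculation by simp
  moreover have "a = a'"
    using e e' calculation by (auto simp: young_edge_def)
  ultimately show ?thesis by simp
qed

lemma step_mono: "u \<le> w \<Longrightarrow> d * (n * d - 2) * u \<le> d * (n * d - 2) * w"
  using d_bounds by (intro mult_left_mono) auto

section \<open>Admissible values of \<open>u\<close> at each source\<close>

lemma u_origin:
  assumes "young_edge g k (0, 0) (A, a) (R, r)"
  shows "n * a - (n + 1) * r \<in> {0, 1}"
proof -
  define u where "u = n * a - (n + 1) * r"
  \<comment> \<open>Naming the product keeps \<open>algebra_simps\<close> from expanding it, so
    \<open>w\<close> counts as a single unknown in the linear estimates.\<close>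
  define w where "w = d * (n * d - 2) * u"
  have b: "- (n * d - 2) \<le> w" "w \<le> (d + 1) * (n * d - 2)"
    using edge_u_bounds[OF assms u_def] by (simp_all add: w_def)
  have "\<not> u \<le> - 1"
  proof
    assume "u \<le> - 1"
    then have "w \<le> d * (n * d - 2) * (- 1)" unfolding w_def by (rule step_mono)
    then show False using b(1) d_bounds n nd_bounds by (simp only: algebra_simps)
  qed
  moreover have "\<not> u \<ge> 2"
  proof
    assume "u \<ge> 2"
    then have "d * (n * d - 2) * 2 \<le> w" unfolding w_def by (rule step_mono)
    then show False using b(2) d_bounds n nd_bounds by (simp only: algebra_simps)
  qed
  ultimately show ?thesis by (auto simp: u_def)
qed

lemma u_A:
  assumes "young_edge g k (d - (n + 1), n * d - (n + 1)) (A, a) (R, r)"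
  shows "n * a - (n + 1) * r = 2 - n"
proof -
  define u where "u = n * a - (n + 1) * r"
  define w where "w = d * (n * d - 2) * u"
  have "k * (n * d - (n + 1)) - g * (d - (n + 1)) = (n * n - n - 1) * d * d + 2 * d"
    by (simp add: k g algebra_simps)
  then have b: "- (n * d - 2) \<le> w + ((n * n - n - 1) * d * d + 2 * d)"
      "w + ((n * n - n - 1) * d * d + 2 * d) \<le> (d + 1) * (n * d - 2)"
    using edge_u_bounds[OF assms u_def] by (simp_all add: w_def)
  \<comment> \<open>The tight case: at \<open>u = 1 - n\<close> the bounded quantity is
    \<open>- d * d + 2 * n * d\<close>, which \<open>d * d \<ge> 3 * (n * d)\<close> pushes just
    below \<open>- (n * d - 2)\<close>.\<close>
  have "\<not> u \<le> 1 - n"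
  proof
    assume "u \<le> 1 - n"
    then have "w \<le> d * (n * d - 2) * (1 - n)" unfolding w_def by (rule step_mono)
    then show False using b(1) d_bounds n nd_bounds by (simp only: algebra_simps)
  qed
  moreover have "\<not> u \<ge> 3 - n"
  proof
    assume "u \<ge> 3 - n"
    then have "d * (n * d - 2) * (3 - n) \<le> w" unfolding w_def by (rule step_mono)
    then show False using b(2) d_bounds n nd_bounds by (simp only: algebra_simps)
  qed
  ultimately show ?thesis by (auto simp: u_def)
qed

lemma u_B:
  assumes "young_edge g k ((n - 1) * (d + 2), (n - 1) * (d + 2)) (A, a) (R, r)"
  shows "n * a - (n + 1) * r = 1"
proof -
  define u where "u = n * a - (n + 1) * r"
  define w where "w = d * (n * d - 2) * u"
  \<comment> \<open>Both coordinates agree and \<open>k - g = - d\<close>.\<close>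
  have "k * ((n - 1) * (d + 2)) - g * ((n - 1) * (d + 2)) = - (d * (n - 1) * (d + 2))"
    by (simp add: k g algebra_simps)
  then have b: "- (n * d - 2) \<le> w + (- (d * (n - 1) * (d + 2)))"
      "w + (- (d * (n - 1) * (d + 2))) \<le> (d + 1) * (n * d - 2)"
    using edge_u_bounds[OF assms u_def] by (simp_all add: w_def)
  have "\<not> u \<le> 0"
  proof
    assume "u \<le> 0"
    then have "w \<le> d * (n * d - 2) * 0" unfolding w_def by (rule step_mono)
    then show False using b(1) d_bounds n nd_bounds by (simp only: algebra_simps)
  qed
  \<comment> \<open>Here \<open>d * d \<ge> 3 * (n * d)\<close> is decisive again: at
    \<open>u = 2\<close> the bounded quantity exceeds the upper bound by
    \<open>d * d - 3 * n * d + 2\<close>.\<close>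
  moreover have "\<not> u \<ge> 2"
  proof
    assume "u \<ge> 2"
    then have "d * (n * d - 2) * 2 \<le> w" unfolding w_def by (rule step_mono)
    then show False using b(2) d_bounds n nd_bounds by (simp only: algebra_simps)
  qed
  ultimately show ?thesis by (auto simp: u_def)
qed

lemma u_C:
  assumes "young_edge g k (n * d - (n + 1), d - (n + 1)) (A, a) (R, r)"
  shows "n * a - (n + 1) * r \<in> {n, n + 1}"
proof -
  define u where "u = n * a - (n + 1) * r"
  define w where "w = d * (n * d - 2) * u"
  \<comment> \<open>The offset is exactly \<open>- n\<close> steps, so the admissible values are
    those of the origin, 0 and 1, shifted by \<open>n\<close>.\<close>
  have "k * (d - (n + 1)) - g * (n * d - (n + 1)) = - (d * (n * d - 2) * n)"
    by (simp add: k g algebra_simps)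
  then have b: "- (n * d - 2) \<le> w + (- (d * (n * d - 2) * n))"
      "w + (- (d * (n * d - 2) * n)) \<le> (d + 1) * (n * d - 2)"
    using edge_u_bounds[OF assms u_def] by (simp_all add: w_def)
  have "\<not> u \<le> n - 1"
  proof
    assume "u \<le> n - 1"
    then have "w \<le> d * (n * d - 2) * (n - 1)" unfolding w_def by (rule step_mono)
    then show False using b(1) d_bounds n nd_bounds by (simp only: algebra_simps)
  qed
  moreover have "\<not> u \<ge> n + 2"
  proof
    assume "u \<ge> n + 2"
    then have "d * (n * d - 2) * (n + 2) \<le> w" unfolding w_def by (rule step_mono)
    then show False using b(2) d_bounds n nd_bounds by (simp only: algebra_simps)
  qed
  ultimately show ?thesis by (auto simp: u_def)
qed

section \<open>Explicit edges and complete lists of out-edges\<close>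

definition "N_A = (d - (n + 1), n * d - (n + 1))"
definition "N_B = ((n - 1) * (d + 2), (n - 1) * (d + 2))"
definition "N_C = (n * d - (n + 1), d - (n + 1))"

text \<open>The existence half of the out-edge lists. Reversing an edge while swapping the
  coordinates of its ends and of its label exchanges the two edge equations; this pairs the edge
  from the origin to \<open>N_A\<close> with that from \<open>N_C\<close> to the origin, pairs
  \<open>N_A\<close> to \<open>N_B\<close> with \<open>N_B\<close> to \<open>N_C\<close>, and fixes
  the other two.\<close>

lemma edges:
  shows edge_0_0: "young_edge g k (0, 0) (0, 0) (0, 0)"
    and edge_0_A: "young_edge g k (0, 0) (1, (n + 1) * d - (n + 2)) N_A"
    and edge_A_B: "young_edge g k N_A ((n + 1) * t - (n + 2), (n\<^sup>2 - 1) * t + 2 * n - 1) N_B"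
    and edge_B_C: "young_edge g k N_B ((n\<^sup>2 - 1) * t + 2 * n - 1, (n + 1) * t - (n + 2)) N_C"
    and edge_C_A: "young_edge g k N_C ((n + 1) * d - (n + 1), (n + 1) * d - (n + 1)) N_A"
    and edge_C_0: "young_edge g k N_C ((n + 1) * d - (n + 2), 1) (0, 0)"
proof -
  (* In m = n - 2 and s = t - 3 the bounds become polynomials with nonnegative coefficients. *)
  obtain m s where ms: "n = m + 2" "t = s + 3" "m \<ge> 0" "s \<ge> 0"
    using n t by (metis diff_add_cancel diff_ge_0_iff_ge)
  have "m * s \<ge> 0" "m * m \<ge> 0" "m * (m * s) \<ge> 0"
    using ms by auto
  note facts = this ms(3,4)
  note defs = young_edge_def k g d ms(1,2) power2_eq_square
  show "young_edge g k (0, 0) (0, 0) (0, 0)"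
    using facts unfolding N_A_def N_B_def N_C_def by (simp add: defs algebra_simps)
  show "young_edge g k (0, 0) (1, (n + 1) * d - (n + 2)) N_A"
    using facts unfolding N_A_def N_B_def N_C_def by (simp add: defs algebra_simps)
  show "young_edge g k N_A ((n + 1) * t - (n + 2), (n\<^sup>2 - 1) * t + 2 * n - 1) N_B"
    using facts unfolding N_A_def N_B_def N_C_def by (simp add: defs algebra_simps)
  show "young_edge g k N_B ((n\<^sup>2 - 1) * t + 2 * n - 1, (n + 1) * t - (n + 2)) N_C"
    using facts unfolding N_A_def N_B_def N_C_def by (simp add: defs algebra_simps)
  show "young_edge g k N_C ((n + 1) * d - (n + 1), (n + 1) * d - (n + 1)) N_A"
    using facts unfolding N_A_def N_B_def N_C_def by (simp add: defs algebra_simps)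
  show "young_edge g k N_C ((n + 1) * d - (n + 2), 1) (0, 0)"
    using facts unfolding N_A_def N_B_def N_C_def by (simp add: defs algebra_simps)
qed

text \<open>Each admissible \<open>u\<close> is realised by one of the known edges, and
  \<open>edge_unique\<close> excludes any other edge with that \<open>u\<close>. The lists for the
  remaining sources follow the same pattern.\<close>

lemma out_origin:
  "young_edge g k (0, 0) l v \<longleftrightarrow>
     l = (0, 0) \<and> v = (0, 0) \<or> l = (1, (n + 1) * d - (n + 2)) \<and> v = N_A"
proof
  assume e: "young_edge g k (0, 0) l v"
  obtain A a R r where lv: "l = (A, a)" "v = (R, r)" by (metis surj_pair)
  consider "n * a - (n + 1) * r = 0" | "n * a - (n + 1) * r = 1"
    using u_origin e lv by blast
  then show "l = (0, 0) \<and> v = (0, 0) \<or> l = (1, (n + 1) * d - (n + 2)) \<and> v = N_A"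
  proof cases
    case 1
    then show ?thesis using edge_unique[OF e[unfolded lv] edge_0_0] lv by simp
  next
    case 2
    have "n * ((n + 1) * d - (n + 2)) - (n + 1) * (n * d - (n + 1)) = 1"
      by (simp add: algebra_simps)
    then show ?thesis
      using edge_unique[OF e[unfolded lv] edge_0_A[unfolded N_A_def]] 2 lv by (simp add: N_A_def)
  qed
qed (auto simp: edges)

lemma out_A:
  "young_edge g k N_A l v \<longleftrightarrow>
     l = ((n + 1) * t - (n + 2), (n\<^sup>2 - 1) * t + 2 * n - 1) \<and> v = N_B"
proof
  assume e: "young_edge g k N_A l v"
  obtain A a R r where lv: "l = (A, a)" "v = (R, r)" by (metis surj_pair)
  show "l = ((n + 1) * t - (n + 2), (n\<^sup>2 - 1) * t + 2 * n - 1) \<and> v = N_B"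
    \<comment> \<open>Applying \<open>u_A\<close> to the known edge as well shows that both edges
      have the same \<open>u\<close>, without evaluating it on the explicit label.\<close>
    using edge_unique[OF e[unfolded lv N_A_def] edge_A_B[unfolded N_A_def N_B_def]]
      u_A[OF e[unfolded lv N_A_def]] u_A[OF edge_A_B[unfolded N_A_def N_B_def]] lv
    by (simp add: N_B_def)
qed (auto simp: edges)

lemma out_B:
  "young_edge g k N_B l v \<longleftrightarrow>
     l = ((n\<^sup>2 - 1) * t + 2 * n - 1, (n + 1) * t - (n + 2)) \<and> v = N_C"
proof
  assume e: "young_edge g k N_B l v"
  obtain A a R r where lv: "l = (A, a)" "v = (R, r)" by (metis surj_pair)
  show "l = ((n\<^sup>2 - 1) * t + 2 * n - 1, (n + 1) * t - (n + 2)) \<and> v = N_C"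
    using edge_unique[OF e[unfolded lv N_B_def] edge_B_C[unfolded N_B_def N_C_def]]
      u_B[OF e[unfolded lv N_B_def]] u_B[OF edge_B_C[unfolded N_B_def N_C_def]] lv
    by (simp add: N_C_def)
qed (auto simp: edges)

lemma out_C:
  "young_edge g k N_C l v \<longleftrightarrow>
     l = ((n + 1) * d - (n + 1), (n + 1) * d - (n + 1)) \<and> v = N_A \<or>
     l = ((n + 1) * d - (n + 2), 1) \<and> v = (0, 0)"
proof
  assume e: "young_edge g k N_C l v"
  obtain A a R r where lv: "l = (A, a)" "v = (R, r)" by (metis surj_pair)
  consider "n * a - (n + 1) * r = n" | "n * a - (n + 1) * r = n + 1"
    using u_C[of A a R r] e lv by (auto simp: N_C_def)
  then show "l = ((n + 1) * d - (n + 1), (n + 1) * d - (n + 1)) \<and> v = N_A \<or>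
     l = ((n + 1) * d - (n + 2), 1) \<and> v = (0, 0)"
  proof cases
    case 1
    then show ?thesis using edge_unique[OF e[unfolded lv N_C_def] edge_C_0[unfolded N_C_def]] lv by simp
  next
    case 2
    have "n * ((n + 1) * d - (n + 1)) - (n + 1) * (n * d - (n + 1)) = n + 1"
      by (simp add: algebra_simps)
    then show ?thesis
      using edge_unique[OF e[unfolded lv N_C_def] edge_C_A[unfolded N_A_def N_C_def]] 2 lv
      by (simp add: N_A_def)
  qed
qed (auto simp: edges)

section \<open>The explicit graph and reachability in it\<close>

abbreviation (input) "v_A \<equiv> case_prod Node N_A"
abbreviation (input) "v_B \<equiv> case_prod Node N_B"
abbreviation (input) "v_C \<equiv> case_prod Node N_C"

definition young :: "(node, labeled_arc) pre_digraph" where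
  "young = \<lparr> verts = {Start, v_A, v_B, v_C, Node 0 0},
     arcs = {(Start, (1, (n + 1) * d - (n + 2)), v_A),
       (v_A, ((n + 1) * t - (n + 2), (n\<^sup>2 - 1) * t + 2 * n - 1), v_B),
       (v_B, ((n\<^sup>2 - 1) * t + 2 * n - 1, (n + 1) * t - (n + 2)), v_C),
       (v_C, ((n + 1) * d - (n + 1), (n + 1) * d - (n + 1)), v_A),
       (v_C, ((n + 1) * d - (n + 2), 1), Node 0 0),
       (Node 0 0, (1, (n + 1) * d - (n + 2)), v_A),
       (Node 0 0, (0, 0), Node 0 0)},
     tail = (\<lambda>(u, l, v). u), head = (\<lambda>(u, l, v). v) \<rparr>"

lemma node_distinct:
  "v_A \<noteq> Node 0 0" "v_B \<noteq> Node 0 0" "v_C \<noteq> Node 0 0" "v_A \<noteq> v_B" "v_B \<noteq> v_C" "v_A \<noteq> v_C"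
  "v_A \<noteq> Start" "v_B \<noteq> Start" "v_C \<noteq> Start"
proof -
  have pos: "d > n + 1" "n * d > n + 1" and ne: "d - (n + 1) \<noteq> n * d - (n + 1)"
    using nd_bounds(3) d_ge n by linarith+
  show "v_A \<noteq> Node 0 0" "v_B \<noteq> Node 0 0" "v_C \<noteq> Node 0 0" "v_A \<noteq> Start" "v_B \<noteq> Start" "v_C \<noteq> Start"
    using pos n by (auto simp: N_A_def N_B_def N_C_def)
  show "v_A \<noteq> v_B" "v_B \<noteq> v_C" "v_A \<noteq> v_C"
    unfolding N_A_def N_B_def N_C_def prod.case node.inject using ne by metis+
qed

lemma node_label_eq_iff: "w \<noteq> Start \<Longrightarrow> node_label w = x \<longleftrightarrow> w = case_prod Node x"
  by (cases w; cases x) auto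

lemma verts_young_subset: "verts young \<subseteq> all_nodes k"
  using edges[THEN young_edge_target] by (auto simp: young_def all_nodes_def)

text \<open>Assembles the out-edge lists. Only the source is assumed to lie in \<open>young\<close>,
  so the equivalence also shows that no arc of the full graph leaves its vertex set.\<close>

lemma arcs_young_iff:
  assumes "v \<in> verts young"
  shows "(v, l, w) \<in> labeled_arcs g k \<longleftrightarrow> (v, l, w) \<in> arcs young"
proof -
  have label: "node_label (case_prod Node x) = x" for x by (cases x) simp
  \<comment> \<open>The nonzero-label condition at \<open>Start\<close> removes the edge labeled
    \<open>(0, 0)\<close>; this fact shows that the edge to \<open>v_A\<close> survives it.\<close>
  have ne: "(n + 1) * d - (n + 2) \<noteq> 0"
    using nd_bounds(3) d_ge n distrib_right[of n 1 d] by linarith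
  obtain a b where l: "l = (a, b)" by (cases l)
  have v: "v \<in> all_nodes k" using assms verts_young_subset by auto
  have "w \<noteq> Start" if "(v, l, w) \<in> arcs young"
    using that node_distinct by (auto simp: young_def)
  moreover have "(v, l, w) \<in> labeled_arcs g k \<longleftrightarrow> (v, l, w) \<in> arcs young" if w: "w \<noteq> Start"
  proof -
    consider "v = Start" | "v = v_A" | "v = v_B" | "v = v_C" | "v = Node 0 0"
      using assms by (auto simp: young_def)
    then show ?thesis
    proof cases
      case 1
      then show ?thesis using v w ne node_distinct
        by (auto simp: l labeled_arcs_iff out_origin node_label_eq_iff young_def)
    next
      case 2
      then show ?thesis using v w node_distinct
        by (simp add: l labeled_arcs_iff label out_A node_label_eq_iff young_def)
    next
      case 3
      then show ?thesis using v w node_distinct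
        by (simp add: l labeled_arcs_iff label out_B node_label_eq_iff young_def)
    next
      case 4
      then show ?thesis using v w node_distinct
        by (auto simp: l labeled_arcs_iff label out_C node_label_eq_iff young_def)
    next
      case 5
      then show ?thesis using v w node_distinct
        by (auto simp: l labeled_arcs_iff out_origin node_label_eq_iff young_def)
    qed
  qed
  ultimately show ?thesis by (auto simp: l labeled_arcs_iff)
qed

lemma wf_young: "wf_digraph young"
  by unfold_locales (auto simp: young_def)

lemma arcs_ends_young:
  "arcs_ends young = {(Start, v_A), (v_A, v_B), (v_B, v_C), (v_C, v_A), (v_C, Node 0 0), (Node 0 0, v_A), (Node 0 0, Node 0 0)}"
  by (simp add: young_def arcs_ends_conv)

text \<open>Every vertex reaches \<open>v_A\<close>, from where the walk through \<open>v_B\<close>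
  and \<open>v_C\<close> to \<open>Node 0 0\<close> meets all possible targets. Taking
  \<open>u = Start\<close> serves to find \<open>H_graph\<close>, taking \<open>v = Node 0 0\<close>
  to find \<open>Y_graph\<close>.\<close>

lemma reachable_young:
  assumes "u \<in> verts young" "v \<in> verts young - {Start}"
  shows "u \<rightarrow>\<^sup>*\<^bsub>young\<^esub> v"
proof -
  interpret wf_digraph young by (rule wf_young)
  have AB: "v_A \<rightarrow>\<^sup>*\<^bsub>young\<^esub> v_B" and BC: "v_B \<rightarrow>\<^sup>*\<^bsub>young\<^esub> v_C" and C0: "v_C \<rightarrow>\<^sup>*\<^bsub>young\<^esub> Node 0 0"
    by (auto simp: arcs_ends_young)
  have uA: "u \<rightarrow>\<^sup>*\<^bsub>young\<^esub> v_A"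
  proof -
    have "x \<rightarrow>\<^sup>*\<^bsub>young\<^esub> v_A" if "x \<in> {Start, v_C, Node 0 0}" for x
      using that by (auto simp: arcs_ends_young)
    moreover have "v_A \<rightarrow>\<^sup>*\<^bsub>young\<^esub> v_A" by (rule reachable_refl) (simp add: young_def)
    moreover have "v_B \<rightarrow>\<^sup>*\<^bsub>young\<^esub> v_A" using BC calculation(1)[of v_C] by (auto intro: reachable_trans)
    ultimately show ?thesis using assms(1) by (auto simp: young_def)
  qed
  note uB = reachable_trans[OF uA AB]
  note uC = reachable_trans[OF uB BC]
  show ?thesis using assms(2) uA uB uC reachable_trans[OF uC C0] by (auto simp: young_def)
qed

section \<open>Identification of \<open>H_graph\<close> and \<open>Y_graph\<close>\<close>

lemma wf_full_graph: "wf_digraph (full_graph g k)"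
  by unfold_locales (auto simp: full_graph_def labeled_arcs_def)

lemma full_graph_restrict_young: "full_graph g k \<restriction> verts young = young"
proof (rule pre_digraph.equality)
  show "arcs (full_graph g k \<restriction> verts young) = arcs young"
  proof (rule set_eqI)
    fix e :: labeled_arc
    obtain u l v where e: "e = (u, l, v)" by (cases e)
    have "tail young (u, l, v) = u" "head young (u, l, v) = v" by (simp_all add: young_def)
    then show "e \<in> arcs (full_graph g k \<restriction> verts young) \<longleftrightarrow> e \<in> arcs young"
      using wf_digraph.wellformed[OF wf_young, of e] arcs_young_iff[of u l v]
      by (auto simp: e full_graph_def)
  qed
qed (auto simp: full_graph_def young_def)

text \<open>One inclusion is closure of the vertex set under arcs, by induction along a walk; for
  the other, walks in the induced subgraph \<open>young\<close> are walks in the full graph.\<close>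

lemma reachable_full_graph: "{v. Start \<rightarrow>\<^sup>*\<^bsub>full_graph g k\<^esub> v} = verts young"
proof (intro set_eqI iffI; clarify?)
  interpret wf_digraph "full_graph g k" by (rule wf_full_graph)
  fix v
  show "v \<in> verts young" if "Start \<rightarrow>\<^sup>*\<^bsub>full_graph g k\<^esub> v"
    using that
  proof (induction rule: reachable_induct)
    case base
    show ?case by (simp add: young_def)
  next
    case (step x y)
    then obtain l where "(x, l, y) \<in> labeled_arcs g k"
      by (auto simp: full_graph_def arcs_ends_conv)
    then have "(x, l, y) \<in> arcs young" using step by (simp add: arcs_young_iff)
    then show ?case using wf_digraph.head_in_verts[OF wf_young, of "(x, l, y)"]
      by (simp add: young_def)
  qed
  assume v: "v \<in> verts young"
  show "Start \<rightarrow>\<^sup>*\<^bsub>full_graph g k\<^esub> v"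
  proof (cases "v = Start")
    case True
    have "Start \<in> verts (full_graph g k)" by (simp add: full_graph_def all_nodes_def)
    then show ?thesis using True by blast
  next
    case False
    then have "Start \<rightarrow>\<^sup>*\<^bsub>full_graph g k \<restriction> verts young\<^esub> v"
      using v reachable_young[of Start v] unfolding full_graph_restrict_young
      by (simp add: young_def)
    then show ?thesis
      using reachable_induce_subgraphD verts_young_subset by (simp add: full_graph_def)
  qed
qed

lemma H_graph_eq: "H_graph g k = young"
  by (simp add: H_graph_def reachable_full_graph full_graph_restrict_young)

text \<open>Pruning deletes nothing, since every vertex reaches the even pivot
  \<open>Node 0 0\<close>.\<close>

lemma Y_graph_eq: "Y_graph g k = young"
proof -
  have "pivot young (Node 0 0)" "Node 0 0 \<in> verts young - {Start}"
    by (auto simp: pivot_def even_pivot_def young_def)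
  then have "{u \<in> verts young. \<exists>v. pivot young v \<and> u \<rightarrow>\<^sup>*\<^bsub>young\<^esub> v} = verts young"
    using reachable_young by blast
  moreover have "young \<restriction> verts young = young"
    using wf_digraph.wellformed[OF wf_young] by (auto intro: pre_digraph.equality)
  ultimately show ?thesis by (simp add: Y_graph_def H_graph_eq)
qed

section \<open>Membership in the class of cyclic Young graphs\<close>

lemma cyclic_digraph_3:
  "cyclic_digraph 3 = \<lparr> verts = {0, 1, 2}, arcs = {(0, 1), (1, 2), (2, 0)}, tail = fst, head = snd \<rparr>"
proof -
  have lt: "i < 3 \<longleftrightarrow> i = 0 \<or> i = 1 \<or> i = 2" for i :: nat by auto
  have "{(i, Suc i mod 3) | i. i < 3} = {(0, 1), (1, 2), (2, 0)}"
    unfolding lt by auto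
  then show ?thesis by (auto simp: cyclic_digraph_def lt lessThan_def)
qed

lemma is_cyclic_young_young: "is_cyclic_young 3 young"
proof -
  note [simp] = node_distinct node_distinct[symmetric]
  define G where "G = young \<restriction> (verts young - {Start, Node 0 0})"
  have verts: "verts G = {v_A, v_B, v_C}" by (auto simp: G_def young_def)
  have arcs: "arcs G = {(v_A, ((n + 1) * t - (n + 2), (n\<^sup>2 - 1) * t + 2 * n - 1), v_B),
       (v_B, ((n\<^sup>2 - 1) * t + 2 * n - 1, (n + 1) * t - (n + 2)), v_C),
       (v_C, ((n + 1) * d - (n + 1), (n + 1) * d - (n + 1)), v_A)}"
    by (auto simp: G_def young_def)
  have ends: "tail G = (\<lambda>(u, l, v). u)" "head G = (\<lambda>(u, l, v). v)"
    by (simp_all add: G_def young_def)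
  \<comment> \<open>Numbers the three nodes in cycle order; \<open>v_C\<close> receives the default
    value 2.\<close>
  define f :: "node \<Rightarrow> nat" where "f v = (if v = v_A then 0 else if v = v_B then 1 else 2)" for v
  have f: "f v_A = 0" "f v_B = 1" "f v_C = 2" by (simp_all add: f_def)
  \<comment> \<open>The arc map forgets labels, yet is injective on \<open>G\<close> because no two
    of its arcs share both ends.\<close>
  define h where "h = \<lparr> iso_verts = f, iso_arcs = (\<lambda>(u, l :: int \<times> int, v). (f u, f v)),
      iso_head = snd, iso_tail = fst \<rparr>"
  have "wf_digraph G"
    unfolding G_def by (rule wf_digraph.wellformed_induce_subgraph[OF wf_young])
  then have "pre_digraph.digraph_isomorphism G h"
    by (auto simp: pre_digraph.digraph_isomorphism_def h_def inj_on_def verts arcs ends f)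
  moreover have "cyclic_digraph 3 = app_iso h G"
    by (simp add: cyclic_digraph_3 app_iso_def h_def verts arcs f)
  ultimately have "digraph_iso G (cyclic_digraph 3)"
    unfolding digraph_iso_def by blast
  \<comment> \<open>The witnesses are \<open>v_C\<close> for \<open>N1\<close> and
    \<open>v_A\<close> for \<open>N2\<close>.\<close>
  moreover have "v_A \<noteq> Node 0 0 \<and> v_C \<rightarrow>\<^bsub>young\<^esub> v_A \<and>
        {u. u \<rightarrow>\<^bsub>young\<^esub> Node 0 0} - {Node 0 0} = {v_C} \<and>
        {v. Node 0 0 \<rightarrow>\<^bsub>young\<^esub> v} - {Node 0 0} = {v_A} \<and>
        {v. Start \<rightarrow>\<^bsub>young\<^esub> v} = {v_A}"
    by (auto simp: arcs_ends_young)
  ultimately show ?thesis unfolding is_cyclic_young_def G_def by blast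
qed

lemma Y_graph_in_Z_class: "Y_graph g k \<in> Z_class 3"
proof -
  have "2 \<le> k" "k < g" using d_bounds by (auto simp: k g distrib_right)
  then show ?thesis
    unfolding Z_class_def using is_cyclic_young_young
    by (intro CollectI exI[of _ g] exI[of _ k]) (simp add: Y_graph_eq)
qed

end

theorem theorem5:
  fixes t n g k :: int and N_A N_B N_C :: node
  assumes "t \<ge> 3" and "n \<ge> 2"
    and "g = (n^2 + n) * t - 1"
    and "k = n^2 * t - 1"
    and "N_A = Node (n * t - (n + 1)) (n^2 * t - (n + 1))"
    and "N_B = Node ((n^2 - n) * t + 2 * n - 2) ((n^2 - n) * t + 2 * n - 2)"
    and "N_C = Node (n^2 * t - (n + 1)) (n * t - (n + 1))"
  shows "Y_graph g k \<in> Z_class 3 \<and>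
    verts (Y_graph g k) = {Start, N_A, N_B, N_C, Node 0 0} \<and>
    arcs (Y_graph g k) =
      {(Start, (1, (n^2 + n) * t - (n + 2)), N_A),
       (N_A, ((n + 1) * t - (n + 2), (n^2 - 1) * t + 2 * n - 1), N_B),
       (N_B, ((n^2 - 1) * t + 2 * n - 1, (n + 1) * t - (n + 2)), N_C),
       (N_C, ((n^2 + n) * t - (n + 1), (n^2 + n) * t - (n + 1)), N_A),
       (N_C, ((n^2 + n) * t - (n + 2), 1), Node 0 0),
       (Node 0 0, (1, (n^2 + n) * t - (n + 2)), N_A),
       (Node 0 0, (0, 0), Node 0 0)}"
proof -
  interpret young_params n t "n * t" g k
    using assms by unfold_locales (simp_all add: power2_eq_square algebra_simps)
  have nodes: "v_A = N_A" "v_B = N_B" "v_C = N_C"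
    using assms(5-7)
    by (simp_all add: N_A_def N_B_def N_C_def power2_eq_square algebra_simps)
  \<comment> \<open>Turns the arc labels, written with \<open>d = n * t\<close> in the locale, into
    the form of the claim.\<close>
  have "(n + 1) * (n * t) = (n\<^sup>2 + n) * t"
    by (simp add: power2_eq_square algebra_simps)
  then show ?thesis
    using Y_graph_in_Z_class by (simp only: Y_graph_eq young_def nodes pre_digraph.simps simp_thms)
qed

end
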